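(* Let $\mathcal{P}(\mathbb{P},\Xi)$ be a problem instance such that: (i) the objective is deterministic: $\boldsymbol{c}(\boldsymbol{\xi})^\intercal\boldsymbol{x}(\boldsymbol{\xi})=\boldsymbol{c}^\intercal\boldsymbol{x}_0$; (ii) for each $g\in[G]$, $\boldsymbol{b}_g(\boldsymbol{\xi})=\boldsymbol{B}_g\boldsymbol{\xi}+\hat{\boldsymbol{b}}_g$ with $\boldsymbol{B}_g,\hat{\boldsymbol{b}}_g\le\boldsymbol{0}$ (entrywise); (iii) for each $g\in[G]$, $\Xi_g$ is contained in the non-negative orthant, full-dimensional, and down-monotone ($\boldsymbol{\xi}\in\Xi_g$ and $\boldsymbol{0}\le\hat{\boldsymbol{\xi}}\le\boldsymbol{\xi}$ imply $\hat{\boldsymbol{\xi}}\in\Xi_g$). Let the embedding $\boldsymbol{E}$ be such that, for each $g\in[G]$, the embedded support $\Theta_g$ is convex, contained in the non-negative orthant, full-dimensional with $\boldsymbol{e}_i\in\Theta_g$ for all $i\in[I]$, and down-monotone. Then $$\mathrm{Aff}\,\mathcal{P}'(\mathbb{P}',\overline{\Xi}^\star)\ \le\ \min_{\boldsymbol{z}\in Z}\Big\{\beta(\boldsymbol{z})+\max_{g\in[G]}\overline{d}_g([\boldsymbol{0},\boldsymbol{z}])\Big\}\cdot\mathcal{P}(\mathbb{P},\Xi)$$ and $$\mathrm{Aff}\,\mathcal{P}'(\mathbb{P}',\overline{\Xi}^{\mathrm{A}})\ \le\ \min_{\boldsymbol{z}\in Z^{\mathrm{A}}}\Big\{\beta(\boldsymbol{z})+\max_{g\in[G]}\overline{d}_g([\boldsymbol{0},\boldsymbol{z}])\Big\}\cdot\mathcal{P}(\mathbb{P},\Xi),$$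 where each problem symbol stands for the optimal value of that problem.
   Context: Notation: $[n]=\{1,\dots,n\}$, $[n]_0=[n]\cup\{0\}$; $\boldsymbol{e}_i$ is the $i$-th unit vector. For a family of sets $\Xi=\{\Xi_g\}_{g\in[G]}$, $\Xi$ also denotes the union. Problem. The uncertain parameters $\boldsymbol{\xi}=(\boldsymbol{\xi}_1,\dots,\boldsymbol{\xi}_T)\in\mathbb{R}^N$ are revealed over stages $t\in[T]$, and $\boldsymbol{\xi}^t=(\boldsymbol{\xi}_1,\dots,\boldsymbol{\xi}_t)$. They are governed by a probability distribution $\mathbb{P}$ supported on a family of compact sets $\Xi=\{\Xi_g\}_{g\in[G]}$. Problem $\mathcal{P}(\mathbb{P},\Xi)$ is $$\min_{\boldsymbol{x}\in\mathcal{F}}\ \mathbb{E}_{\mathbb{P}}[\boldsymbol{c}(\tilde{\boldsymbol{\xi}})^\intercal\boldsymbol{x}(\tilde{\boldsymbol{\xi}})]\quad\text{s.t.}\quad \boldsymbol{A}_g\boldsymbol{x}(\boldsymbol{\xi})\le\boldsymbol{b}_g(\boldsymbol{\xi})\ \ \forall g\in[G],\ \boldsymbol{\xi}\in\Xi_g,$$ with $\boldsymbol{A}_g$ fixed matrices and $\boldsymbol{c}(\cdot),\boldsymbol{b}_g(\cdot)$ affine. $\mathcal{F}$ is the set of non-anticipative decision rules $\boldsymbol{x}(\cdot)=(\boldsymbol{x}_0,\boldsymbol{x}_1(\cdot),\dots,\boldsymbol{x}_T(\cdot))$: $\boldsymbol{x}_0$ is constant and $\boldsymbol{x}_t$ depends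 on $\boldsymbol{\xi}$ only through $\boldsymbol{\xi}^t$. Lifting. Matrices $\boldsymbol{E}_t$ define $\boldsymbol{\theta}_t=\boldsymbol{E}_t\boldsymbol{\xi}^t$; for each $t$ the linear map $\boldsymbol{E}^t:\boldsymbol{\xi}^t\mapsto\boldsymbol{\theta}^t=(\boldsymbol{\theta}_1,\dots,\boldsymbol{\theta}_t)$ is injective. Put $\boldsymbol{E}=\boldsymbol{E}^T$, $\Theta_g=\boldsymbol{E}\Xi_g\subseteq\mathbb{R}^I$, $\Theta=\bigcup_g\Theta_g$. For each $i\in[I]$ let $\underline{\theta}_i=\min_{\boldsymbol\theta\in\Theta}\theta_i$, $\overline{\theta}_i=\max_{\boldsymbol\theta\in\Theta}\theta_i$ and choose $\underline{\theta}_i=z_{i0}<z_{i1}<\dots<z_{iJ_i}=\overline{\theta}_i$. The folding operator $F$ has components, for $i\in[I],j\in[J_i]$: $F_{ij}(\theta_i)=0$ if $\theta_i<z_{i,j-1}$; $F_{ij}(\theta_i)=\theta_i-z_{i,j-1}$ if $\theta_i\in[z_{i,j-1},z_{ij}]$; $F_{ij}(\theta_i)=z_{ij}-z_{i,j-1}$ if $\theta_i>z_{ij}$. Lifted vectors $\boldsymbol{\xi}'\in\mathbb{R}^{N'}$, $N'=\sum_iJ_i$, have components $\xi'_{ij}$. The left-inverses are $\boldsymbol{E}^+=(\boldsymbol{E}^\intercal\boldsymbol{E})^{-1}\boldsymbol{E}^\intercal$ and $F^+$ with $F^+_i(\boldsymbol{\xi}')=\underline{\theta}_i+\sum_{j\in[J_i]}\xi'_{ij}$.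 Set $L=F\circ\boldsymbol{E}$, $R=\boldsymbol{E}^+\circ F^+$, $\Xi'_g=L(\Xi_g)$, and let $\mathbb{P}'$ be the push-forward of $\mathbb{P}$ under $L$. For a family $S=\{S_g\}_{g\in[G]}$ of subsets of $\mathbb{R}^{N'}$, $\mathcal{P}'(\mathbb{P}',S)$ is $$\min_{\boldsymbol{x}'\in\mathcal{F}'}\ \mathbb{E}_{\mathbb{P}'}[\boldsymbol{c}(R(\tilde{\boldsymbol{\xi}}'))^\intercal\boldsymbol{x}'(\tilde{\boldsymbol{\xi}}')]\quad\text{s.t.}\quad\boldsymbol{A}_g\boldsymbol{x}'(\boldsymbol{\xi}')\le\boldsymbol{b}_g(R(\boldsymbol{\xi}'))\ \ \forall g\in[G],\ \boldsymbol{\xi}'\in S_g,$$ where $\mathcal{F}'$ encodes non-anticipativity in the lifted space ($\boldsymbol{x}'_0$ is constant; $\boldsymbol{x}'_t$ depends only on the components $\xi'_{ij}$ for which $\theta_i$ is a component of $\boldsymbol{\theta}^t$). $\mathrm{Aff}\,\mathcal{P}'$ denotes the same problem with decision rules additionally restricted to be affine. Outer approximations. Let $[\underline{\boldsymbol\theta}_g,\overline{\boldsymbol\theta}_g]$ be the smallest hyperrectangle containing $\Theta_g$ and $\overline{\Xi}'_g=\{\boldsymbol{\xi}': F^+(\boldsymbol{\xi}')\in\Theta_g\}\cap\mathrm{conv}(F([\underline{\boldsymbol\theta}_g,\overline{\boldsymbol\theta}_g]))$. Let $Z=\times_{i\in[I]}\{z_{ij}:j\in[J_i]_0\}$ and $\mathcal{Z}=\{[\boldsymbol{z}^-,\boldsymbol{z}^+]:\boldsymbol{z}^-,\boldsymbol{z}^+\in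 Z,\ \boldsymbol{z}^-\le\boldsymbol{z}^+\}$. For $[\boldsymbol{z}^-,\boldsymbol{z}^+]\in\mathcal{Z}$ put $$\overline{d}_g([\boldsymbol{z}^-,\boldsymbol{z}^+])=\max_{\boldsymbol\theta\in\Theta_g}\min_{\boldsymbol\theta'\in[\boldsymbol{z}^-,\boldsymbol{z}^+]}\|\boldsymbol\theta-\boldsymbol\theta'\|_1,\quad d'(\boldsymbol{\xi}',[\boldsymbol{z}^-,\boldsymbol{z}^+])=\sum_{i\in[I]}\Big(\sum_{j\in J_i^+}\xi'_{ij}+z_i^--\underline{\theta}_i-\sum_{j\in J_i^-}\xi'_{ij}\Big),$$ where $J_i^+=\{j\in[J_i]:z_i^+<z_{ij}\}$, $J_i^-=\{j\in[J_i]:z_i^-\ge z_{ij}\}$. The cut for $g$ and $[\boldsymbol{z}^-,\boldsymbol{z}^+]$ is the inequality $d'(\boldsymbol{\xi}',[\boldsymbol{z}^-,\boldsymbol{z}^+])\le\overline{d}_g([\boldsymbol{z}^-,\boldsymbol{z}^+])$. The refined outer approximation $\overline{\Xi}^\star=\{\overline{\Xi}^\star_g\}$ has $\overline{\Xi}^\star_g=\{\boldsymbol{\xi}'\in\overline{\Xi}'_g:\text{the cuts for }g\text{ and all }[\boldsymbol{z}^-,\boldsymbol{z}^+]\in\mathcal{Z}\text{ hold}\}$. The outer approximation $\overline{\Xi}^{\mathrm{A}}=\{\overline{\Xi}^{\mathrm{A}}_g\}$ is obtained by only including, for each $g$, the cuts indexed by a subset $\mathcal{Z}^{\mathrm{A}}_g\subseteq\mathcal{Z}$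 (those generated by a cut separation algorithm): $\overline{\Xi}^{\mathrm{A}}_g=\{\boldsymbol{\xi}'\in\overline{\Xi}'_g:\text{the cuts for }g\text{ and all }[\boldsymbol{z}^-,\boldsymbol{z}^+]\in\mathcal{Z}^{\mathrm{A}}_g\text{ hold}\}$. $Z^{\mathrm{A}}\subseteq Z$ is the set of all gridpoints $\boldsymbol{z}$ (here $\boldsymbol{0}\in Z$ and $[\boldsymbol{0},\boldsymbol{z}]\in\mathcal{Z}$) such that for every $g\in[G]$ the cut for $g$ and $[\boldsymbol{0},\boldsymbol{z}]$ is satisfied by all $\boldsymbol{\xi}'\in\overline{\Xi}^{\mathrm{A}}_g$. Scaling factor: $\beta(\boldsymbol\theta)=\min\{\beta'\in\mathbb{R}_+:\exists\boldsymbol\theta'\in\bigcap_{g\in[G]}\Theta_g,\ \beta'\boldsymbol\theta'\ge\boldsymbol\theta\}$. *)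

theory Defs
  imports "HOL-Probability.Probability"
begin

section \<open>General notions\<close>

text \<open>The library has no predicate for affine maps (its \<^const>\<open>affine\<close> is about sets).\<close>

definition affine_map :: "('a::real_vector \<Rightarrow> 'b::real_vector) \<Rightarrow> bool" where
  "affine_map f \<longleftrightarrow> (\<exists>h a. linear h \<and> (\<forall>x. f x = h x + a))"

definition full_dimensional :: "'a::euclidean_space set \<Rightarrow> bool" where
  "full_dimensional S \<longleftrightarrow> aff_dim S = int DIM('a)"

definition down_monotone :: "(real^'n) set \<Rightarrow> bool" where
  "down_monotone S \<longleftrightarrow> (\<forall>v\<in>S. \<forall>w. 0 \<le> w \<and> w \<le> v \<longrightarrow> w \<in> S)"

definition nonneg_orthant :: "(real^'n) set" where
  "nonneg_orthant = {v. 0 \<le> v}"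

definition l1_norm :: "real^'n \<Rightarrow> real" where
  "l1_norm v = (\<Sum>i\<in>UNIV. \<bar>v $ i\<bar>)"

text \<open>A staged vector \<open>(v\<^sub>1, \<dots>, v\<^sub>T)\<close> is a single vector together with a map \<open>s\<close> assigning
  a stage to every component. The history up to \<open>t\<close> is encoded in the same space by setting
  the components of later stages to zero.\<close>

definition history :: "('n \<Rightarrow> nat) \<Rightarrow> nat \<Rightarrow> real^'n \<Rightarrow> real^'n" where
  "history s t v = (\<chi> k. if s k \<le> t then v $ k else 0)"

text \<open>Component \<open>k\<close> of the rule belongs to stage \<open>d k\<close> and may only use the history up to
  \<open>d k\<close>. As the stages \<open>s\<close> of the uncertain parameters will start at 1, the components with
  \<open>d k = 0\<close> are constant.\<close>

definition nonanticipative :: "('n \<Rightarrow> nat) \<Rightarrow> ('m \<Rightarrow> nat) \<Rightarrow> (real^'n \<Rightarrow> real^'m) \<Rightarrow> bool" where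
  "nonanticipative s d x \<longleftrightarrow>
     (\<forall>k v w. history s (d k) v = history s (d k) w \<longrightarrow> x v $ k = x w $ k)"


section \<open>The multistage problem\<close>

text \<open>The matrices for different \<open>g\<close> may have different numbers of rows: only the
  rows in \<open>rows P g\<close> of \<open>lhs P g\<close> and \<open>rhs P g\<close> are constraints of the problem.\<close>

record ('n::finite, 'm::finite, 'r::finite, 'g::finite) msp =
  horizon :: nat
  par_stage :: "'n \<Rightarrow> nat"
  dec_stage :: "'m \<Rightarrow> nat"
  distrib :: "(real^'n) measure"
  supp :: "'g \<Rightarrow> (real^'n) set"
  cost :: "real^'n \<Rightarrow> real^'m"
  rows :: "'g \<Rightarrow> 'r set"
  lhs :: "'g \<Rightarrow> real^'m^'r"
  rhs :: "'g \<Rightarrow> real^'n \<Rightarrow> real^'r"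

definition valid_msp :: "('n::finite, 'm::finite, 'r::finite, 'g::finite) msp \<Rightarrow> bool" where
  "valid_msp P \<longleftrightarrow>
     (\<forall>n. par_stage P n \<in> {1..horizon P}) \<and>
     (\<forall>k. dec_stage P k \<in> {0..horizon P}) \<and>
     prob_space (distrib P) \<and>
     sets (distrib P) = sets borel \<and>
     (AE \<xi> in distrib P. \<xi> \<in> (\<Union>g. supp P g)) \<and>
     (\<forall>g. compact (supp P g)) \<and>
     affine_map (cost P) \<and>
     (\<forall>g. affine_map (rhs P g))"

definition rules :: "('n::finite, 'm::finite, 'r::finite, 'g::finite) msp \<Rightarrow> (real^'n \<Rightarrow> real^'m) set" where
  "rules P = {x. nonanticipative (par_stage P) (dec_stage P) x}"

text \<open>Integrability makes the expectation in the objective meaningful; the Bochner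
  integral of a non-integrable function is 0 by convention.\<close>

definition feasible_rules ::
  "('n::finite, 'm::finite, 'r::finite, 'g::finite) msp \<Rightarrow> (real^'n \<Rightarrow> real^'m) set" where
  "feasible_rules P = {x \<in> rules P.
     integrable (distrib P) (\<lambda>\<xi>. cost P \<xi> \<bullet> x \<xi>) \<and>
     (\<forall>g. \<forall>\<xi>\<in>supp P g. \<forall>r\<in>rows P g. (lhs P g *v x \<xi>) $ r \<le> rhs P g \<xi> $ r)}"

text \<open>Optimal values are extended reals: \<open>\<infinity>\<close> if infeasible, \<open>-\<infinity>\<close> if unbounded.\<close>

definition opt_value :: "('n::finite, 'm::finite, 'r::finite, 'g::finite) msp \<Rightarrow> ereal" where
  "opt_value P = (INF x\<in>feasible_rules P. ereal (LINT \<xi>|distrib P. cost P \<xi> \<bullet> x \<xi>))"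


section \<open>Embedding and lifting\<close>

text \<open>\<open>grid Q i j\<close> is the breakpoint \<open>z\<^sub>i\<^sub>j\<close> for \<open>j \<in> {0..pieces Q i}\<close>. The lifted space is
  \<open>real^'k\<close>, whose coordinates are enumerated by the pairs \<open>(i, j)\<close> with \<open>1 \<le> j \<le> pieces Q i\<close>
  through the bijection \<open>idx Q\<close>.\<close>

record ('n::finite, 'i::finite, 'k::finite) lifting =
  emb :: "real^'n^'i"
  emb_stage :: "'i \<Rightarrow> nat"
  pieces :: "'i \<Rightarrow> nat"
  grid :: "'i \<Rightarrow> nat \<Rightarrow> real"
  idx :: "'k \<Rightarrow> 'i \<times> nat"

definition emb_supp ::
  "('n::finite, 'm::finite, 'r::finite, 'g::finite) msp \<Rightarrow> ('n, 'i::finite, 'k::finite) lifting \<Rightarrow> 'g \<Rightarrow> (real^'i) set" where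
  "emb_supp P Q g = (\<lambda>\<xi>. emb Q *v \<xi>) ` supp P g"

definition emb_lower ::
  "('n::finite, 'm::finite, 'r::finite, 'g::finite) msp \<Rightarrow> ('n, 'i::finite, 'k::finite) lifting \<Rightarrow> 'i \<Rightarrow> real" where
  "emb_lower P Q i = (INF \<theta>\<in>(\<Union>g. emb_supp P Q g). \<theta> $ i)"

definition emb_upper ::
  "('n::finite, 'm::finite, 'r::finite, 'g::finite) msp \<Rightarrow> ('n, 'i::finite, 'k::finite) lifting \<Rightarrow> 'i \<Rightarrow> real" where
  "emb_upper P Q i = (SUP \<theta>\<in>(\<Union>g. emb_supp P Q g). \<theta> $ i)"

text \<open>The second conjunct says that the stage-\<open>t\<close> part of the embedding is a linear function of
  the parameter history up to \<open>t\<close>, the third that the induced map between histories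
  up to \<open>t\<close> is injective.\<close>

definition valid_lifting ::
  "('n::finite, 'm::finite, 'r::finite, 'g::finite) msp \<Rightarrow> ('n, 'i::finite, 'k::finite) lifting \<Rightarrow> bool" where
  "valid_lifting P Q \<longleftrightarrow>
     (\<forall>i. emb_stage Q i \<in> {1..horizon P}) \<and>
     (\<forall>i n. emb_stage Q i < par_stage P n \<longrightarrow> emb Q $ i $ n = 0) \<and>
     (\<forall>t\<in>{1..horizon P}.
        inj_on (\<lambda>\<xi>. history (emb_stage Q) t (emb Q *v \<xi>)) (range (history (par_stage P) t))) \<and>
     (\<forall>i. grid Q i 0 = emb_lower P Q i \<and> grid Q i (pieces Q i) = emb_upper P Q i \<and>
          (\<forall>j<pieces Q i. grid Q i j < grid Q i (Suc j))) \<and>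
     bij_betw (idx Q) UNIV (SIGMA i:UNIV. {1..pieces Q i})"

definition lcomp :: "('n::finite, 'i::finite, 'k::finite) lifting \<Rightarrow> real^'k \<Rightarrow> 'i \<Rightarrow> nat \<Rightarrow> real" where
  "lcomp Q \<xi>' i j = \<xi>' $ (inv (idx Q) (i, j))"

definition folding_comp :: "('n::finite, 'i::finite, 'k::finite) lifting \<Rightarrow> 'i \<Rightarrow> nat \<Rightarrow> real \<Rightarrow> real" where
  "folding_comp Q i j u =
     (if u < grid Q i (j - 1) then 0
      else if u \<le> grid Q i j then u - grid Q i (j - 1)
      else grid Q i j - grid Q i (j - 1))"

definition folding :: "('n::finite, 'i::finite, 'k::finite) lifting \<Rightarrow> real^'i \<Rightarrow> real^'k" where
  "folding Q \<theta> = (\<chi> k. case idx Q k of (i, j) \<Rightarrow> folding_comp Q i j (\<theta> $ i))"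

definition folding_linv ::
  "('n::finite, 'm::finite, 'r::finite, 'g::finite) msp \<Rightarrow> ('n, 'i::finite, 'k::finite) lifting \<Rightarrow> real^'k \<Rightarrow> real^'i" where
  "folding_linv P Q \<xi>' = (\<chi> i. emb_lower P Q i + (\<Sum>j\<in>{1..pieces Q i}. lcomp Q \<xi>' i j))"

definition emb_linv :: "('n::finite, 'i::finite, 'k::finite) lifting \<Rightarrow> real^'i^'n" where
  "emb_linv Q = matrix_inv (transpose (emb Q) ** emb Q) ** transpose (emb Q)"

definition lift :: "('n::finite, 'i::finite, 'k::finite) lifting \<Rightarrow> real^'n \<Rightarrow> real^'k" where
  "lift Q \<xi> = folding Q (emb Q *v \<xi>)"

definition retract ::
  "('n::finite, 'm::finite, 'r::finite, 'g::finite) msp \<Rightarrow> ('n, 'i::finite, 'k::finite) lifting \<Rightarrow> real^'k \<Rightarrow> real^'n" where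
  "retract P Q \<xi>' = emb_linv Q *v folding_linv P Q \<xi>'"

definition lifted_distrib ::
  "('n::finite, 'm::finite, 'r::finite, 'g::finite) msp \<Rightarrow> ('n, 'i::finite, 'k::finite) lifting \<Rightarrow> (real^'k) measure" where
  "lifted_distrib P Q = distr (distrib P) borel (lift Q)"

definition lifted_rules ::
  "('n::finite, 'm::finite, 'r::finite, 'g::finite) msp \<Rightarrow> ('n, 'i::finite, 'k::finite) lifting \<Rightarrow> (real^'k \<Rightarrow> real^'m) set" where
  "lifted_rules P Q = {x'. nonanticipative (\<lambda>k. emb_stage Q (fst (idx Q k))) (dec_stage P) x'}"

definition lifted_feasible_rules ::
  "('n::finite, 'm::finite, 'r::finite, 'g::finite) msp \<Rightarrow> ('n, 'i::finite, 'k::finite) lifting \<Rightarrow>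
   ('g \<Rightarrow> (real^'k) set) \<Rightarrow> (real^'k \<Rightarrow> real^'m) set" where
  "lifted_feasible_rules P Q S = {x' \<in> lifted_rules P Q.
     integrable (lifted_distrib P Q) (\<lambda>\<xi>'. cost P (retract P Q \<xi>') \<bullet> x' \<xi>') \<and>
     (\<forall>g. \<forall>\<xi>'\<in>S g. \<forall>r\<in>rows P g.
        (lhs P g *v x' \<xi>') $ r \<le> rhs P g (retract P Q \<xi>') $ r)}"

definition aff_lifted_opt_value ::
  "('n::finite, 'm::finite, 'r::finite, 'g::finite) msp \<Rightarrow> ('n, 'i::finite, 'k::finite) lifting \<Rightarrow>
   ('g \<Rightarrow> (real^'k) set) \<Rightarrow> ereal" where
  "aff_lifted_opt_value P Q S =
     (INF x'\<in>{x' \<in> lifted_feasible_rules P Q S. affine_map x'}.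
        ereal (LINT \<xi>'|lifted_distrib P Q. cost P (retract P Q \<xi>') \<bullet> x' \<xi>'))"


section \<open>Outer approximations\<close>

definition bounding_box :: "'a::euclidean_space set \<Rightarrow> 'a set" where
  "bounding_box S = (\<lambda>B. \<exists>l u. B = cbox l u) hull S"

definition outer_approx ::
  "('n::finite, 'm::finite, 'r::finite, 'g::finite) msp \<Rightarrow> ('n, 'i::finite, 'k::finite) lifting \<Rightarrow> 'g \<Rightarrow> (real^'k) set" where
  "outer_approx P Q g = {\<xi>'. folding_linv P Q \<xi>' \<in> emb_supp P Q g} \<inter>
     convex hull (folding Q ` bounding_box (emb_supp P Q g))"

definition gridpoints :: "('n::finite, 'i::finite, 'k::finite) lifting \<Rightarrow> (real^'i) set" where
  "gridpoints Q = {z. \<forall>i. z $ i \<in> grid Q i ` {0..pieces Q i}}"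

text \<open>The box \<open>[z\<^sup>-, z\<^sup>+]\<close> is represented by the pair \<open>(z\<^sup>-, z\<^sup>+)\<close> of its corners.\<close>

definition gridboxes :: "('n::finite, 'i::finite, 'k::finite) lifting \<Rightarrow> ((real^'i) \<times> (real^'i)) set" where
  "gridboxes Q = {(zm, zp). zm \<in> gridpoints Q \<and> zp \<in> gridpoints Q \<and> zm \<le> zp}"

definition box_dist ::
  "('n::finite, 'm::finite, 'r::finite, 'g::finite) msp \<Rightarrow> ('n, 'i::finite, 'k::finite) lifting \<Rightarrow>
   'g \<Rightarrow> (real^'i) \<times> (real^'i) \<Rightarrow> real" where
  "box_dist P Q g b =
     (SUP \<theta>\<in>emb_supp P Q g. INF \<theta>'\<in>cbox (fst b) (snd b). l1_norm (\<theta> - \<theta>'))"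

definition lifted_box_dist ::
  "('n::finite, 'm::finite, 'r::finite, 'g::finite) msp \<Rightarrow> ('n, 'i::finite, 'k::finite) lifting \<Rightarrow>
   real^'k \<Rightarrow> (real^'i) \<times> (real^'i) \<Rightarrow> real" where
  "lifted_box_dist P Q \<xi>' b =
     (\<Sum>i\<in>UNIV.
        (\<Sum>j\<in>{j\<in>{1..pieces Q i}. snd b $ i < grid Q i j}. lcomp Q \<xi>' i j)
        + fst b $ i - emb_lower P Q i
        - (\<Sum>j\<in>{j\<in>{1..pieces Q i}. grid Q i j \<le> fst b $ i}. lcomp Q \<xi>' i j))"

definition cut ::
  "('n::finite, 'm::finite, 'r::finite, 'g::finite) msp \<Rightarrow> ('n, 'i::finite, 'k::finite) lifting \<Rightarrow>
   'g \<Rightarrow> (real^'i) \<times> (real^'i) \<Rightarrow> real^'k \<Rightarrow> bool" where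
  "cut P Q g b \<xi>' \<longleftrightarrow> lifted_box_dist P Q \<xi>' b \<le> box_dist P Q g b"

definition cut_outer_approx ::
  "('n::finite, 'm::finite, 'r::finite, 'g::finite) msp \<Rightarrow> ('n, 'i::finite, 'k::finite) lifting \<Rightarrow>
   ('g \<Rightarrow> ((real^'i) \<times> (real^'i)) set) \<Rightarrow> 'g \<Rightarrow> (real^'k) set" where
  "cut_outer_approx P Q ZA g = {\<xi>' \<in> outer_approx P Q g. \<forall>b\<in>ZA g. cut P Q g b \<xi>'}"

definition refined_outer_approx ::
  "('n::finite, 'm::finite, 'r::finite, 'g::finite) msp \<Rightarrow> ('n, 'i::finite, 'k::finite) lifting \<Rightarrow> 'g \<Rightarrow> (real^'k) set" where
  "refined_outer_approx P Q = cut_outer_approx P Q (\<lambda>g. gridboxes Q)"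

definition cut_gridpoints ::
  "('n::finite, 'm::finite, 'r::finite, 'g::finite) msp \<Rightarrow> ('n, 'i::finite, 'k::finite) lifting \<Rightarrow>
   ('g \<Rightarrow> ((real^'i) \<times> (real^'i)) set) \<Rightarrow> (real^'i) set" where
  "cut_gridpoints P Q ZA =
     {z \<in> gridpoints Q. \<forall>g. \<forall>\<xi>'\<in>cut_outer_approx P Q ZA g. cut P Q g (0, z) \<xi>'}"

definition scaling_factor ::
  "('n::finite, 'm::finite, 'r::finite, 'g::finite) msp \<Rightarrow> ('n, 'i::finite, 'k::finite) lifting \<Rightarrow> real^'i \<Rightarrow> real" where
  "scaling_factor P Q \<theta> =
     Inf {\<beta>. 0 \<le> \<beta> \<and> (\<exists>\<theta>'\<in>(\<Inter>g. emb_supp P Q g). \<theta> \<le> \<beta> *\<^sub>R \<theta>')}"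


section \<open>Assumptions on the instance\<close>

definition deterministic_objective :: "('n::finite, 'm::finite, 'r::finite, 'g::finite) msp \<Rightarrow> bool" where
  "deterministic_objective P \<longleftrightarrow>
     (\<exists>c :: real^'m. \<forall>x\<in>rules P. \<forall>\<xi>\<in>(\<Union>g. supp P g).
        cost P \<xi> \<bullet> x \<xi> = (\<Sum>k\<in>{k. dec_stage P k = 0}. c $ k * x \<xi> $ k))"

definition nonpositive_rhs :: "('n::finite, 'm::finite, 'r::finite, 'g::finite) msp \<Rightarrow> bool" where
  "nonpositive_rhs P \<longleftrightarrow>
     (\<forall>g. \<exists>(B :: real^'n^'r) b. (\<forall>\<xi>. rhs P g \<xi> = B *v \<xi> + b) \<and>
        (\<forall>r\<in>rows P g. (\<forall>n. B $ r $ n \<le> 0) \<and> b $ r \<le> 0))"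

end

theory Submission
  imports Defs
begin

text \<open>
  Fix a gridpoint \<open>z\<close> whose cuts \<open>d'(\<xi>', [0, z]) \<le> d\<^sub>g([0, z])\<close> hold on the outer approximation.
  A feasible decision rule \<open>x\<close> of the original problem may be badly nonlinear, but an affine rule
  in the lifted space can be assembled from the values of \<open>x\<close> at finitely many scenarios that
  together dominate every lifted scenario. Write \<open>\<theta> = F\<^sup>+(\<xi>')\<close>. In coordinate \<open>i\<close> the lifted
  components belonging to pieces up to \<open>z\<^sub>i\<close> add up to at most \<open>z\<^sub>i\<close>, because the component of
  each piece is bounded by the length of that piece on the convex hull of the folded points; let
  \<open>u\<^sub>i \<ge> 0\<close> be the sum of the other components, which is linear in \<open>\<xi>'\<close>. So \<open>\<theta> \<le> z + u\<close>. If
  \<open>\<beta> = \<beta>(z)\<close> and \<open>\<theta>\<^sup>*\<close> in the intersection of all \<open>\<Theta>\<^sub>g\<close> satisfies \<open>z \<le> \<beta> \<theta>\<^sup>*\<close>, then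
  \<open>\<theta> \<le> \<beta> \<theta>\<^sup>* + \<Sum>\<^sub>i u\<^sub>i e\<^sub>i\<close>, a nonnegative combination of points of every \<open>\<Theta>\<^sub>g\<close>. With
  \<open>d = max\<^sub>g d\<^sub>g([0, z])\<close>, the affine rule \<open>scenario_rule\<close> is
  \<open>x'(\<xi>') = \<beta> x(E\<^sup>+\<theta>\<^sup>*) + \<Sum>\<^sub>i u\<^sub>i x(E\<^sup>+e\<^sub>i) + (d - \<Sum>\<^sub>i u\<^sub>i) x(0)\<close>.

  Its weights are nonnegative: \<open>\<Sum>\<^sub>i u\<^sub>i\<close> is exactly \<open>d'(\<xi>', [0, z])\<close>, so the cut gives
  \<open>\<Sum>\<^sub>i u\<^sub>i \<le> d\<close>. They add up to \<open>\<beta> + d\<close>, and \<open>\<beta> + d \<ge> 1\<close> (lemma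
  \<open>one_le_scaling_plus_box_dist\<close>). Combining the constraints of \<open>x\<close> at the scenarios with
  these weights bounds \<open>A\<^sub>g x'(\<xi>')\<close> by \<open>B\<^sub>g E\<^sup>+(\<beta> \<theta>\<^sup>* + u) + (\<beta> + d) b\<^sub>g\<close>. As \<open>E\<^sup>+\<close> is monotone
  and \<open>B\<^sub>g\<close> and \<open>b\<^sub>g\<close> are nonpositive, this is at most \<open>B\<^sub>g R(\<xi>') + b\<^sub>g\<close>
  (lemma \<open>scenario_rule_feasible\<close>).

  Non-anticipativity survives because \<open>u\<^sub>i\<close> is multiplied by \<open>x(E\<^sup>+e\<^sub>i) - x(0)\<close>, and the history
  of \<open>E\<^sup>+e\<^sub>i\<close> vanishes before the stage of coordinate \<open>i\<close>: the earlier components of this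
  difference are zero. In particular the here-and-now decision is \<open>(\<beta> + d) x\<^sub>0\<close>, so the
  deterministic objective is scaled by exactly \<open>\<beta> + d\<close>. The minimum over \<open>z\<close> is attained,
  since the set of admissible gridpoints is finite and contains \<open>0\<close>. The refined
  approximation is the case in which all boxes provide cuts, where every gridpoint is admissible.
\<close>

section \<open>Folding\<close>

lemma grid_less:
  assumes "valid_lifting P Q" "a < b" "b \<le> pieces Q i"
  shows "grid Q i a < grid Q i b"
  using assms(2,3)
proof (induction b)
  case (Suc b)
  have step: "grid Q i b < grid Q i (Suc b)"
    using assms(1) Suc.prems unfolding valid_lifting_def by auto
  show ?case
  proof (cases "a = b")
    case False
    then have "grid Q i a < grid Q i b" using Suc by auto
    then show ?thesis using step by linarith
  qed (use step in simp)
qed simp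

lemma grid_le_iff:
  assumes "valid_lifting P Q" "a \<le> pieces Q i" "b \<le> pieces Q i"
  shows "grid Q i a \<le> grid Q i b \<longleftrightarrow> a \<le> b"
  using grid_less[OF assms(1), of a b i] grid_less[OF assms(1), of b a i] assms(2,3)
  by (cases a b rule: linorder_cases) auto

lemma sum_grid_increments:
  "(\<Sum>j\<in>{1..m}. grid Q i j - grid Q i (j - 1)) = grid Q i m - grid Q i 0"
  by (induction m) auto

text \<open>In contrast to the definition by cases, this form exhibits continuity and the bounds.\<close>
lemma folding_comp_clamp:
  assumes "grid Q i (j - 1) \<le> grid Q i j"
  shows "folding_comp Q i j u = max 0 (min (u - grid Q i (j - 1)) (grid Q i j - grid Q i (j - 1)))"
  using assms unfolding folding_comp_def by auto

lemma grid_pred_le: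
  assumes "valid_lifting P Q" "j \<in> {1..pieces Q i}"
  shows "grid Q i (j - 1) \<le> grid Q i j"
  using assms grid_less[OF assms(1), of "j - 1" j i] by auto

text \<open>The pieces cut the interval from the first breakpoint up to \<open>u\<close> into consecutive segments,
  so their lengths telescope.\<close>
lemma sum_folding_comp:
  assumes "valid_lifting P Q" "m \<le> pieces Q i" "grid Q i 0 \<le> u"
  shows "(\<Sum>j\<in>{1..m}. folding_comp Q i j u) = min u (grid Q i m) - grid Q i 0"
  using assms(2)
proof (induction m)
  case 0
  then show ?case using assms(3) by simp
next
  case (Suc m)
  have "grid Q i m < grid Q i (Suc m)"
    using grid_less[OF assms(1), of m "Suc m" i] Suc.prems by simp
  then show ?case using Suc by (auto simp: folding_comp_clamp)
qed

lemma idx_range: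
  assumes "valid_lifting P Q" and "idx Q k = (i, j)"
  shows "j \<in> {1..pieces Q i}"
  using assms unfolding valid_lifting_def bij_betw_def by (metis SigmaE2 rangeI)

lemma idx_inv:
  assumes "valid_lifting P Q" "j \<in> {1..pieces Q i}"
  shows "idx Q (inv (idx Q) (i, j)) = (i, j)"
  by (rule f_inv_into_f) (use assms in \<open>auto simp: valid_lifting_def bij_betw_def\<close>)

lemma lcomp_folding:
  assumes "valid_lifting P Q" "j \<in> {1..pieces Q i}"
  shows "lcomp Q (folding Q \<theta>) i j = folding_comp Q i j (\<theta> $ i)"
  using idx_inv[OF assms] by (simp add: lcomp_def folding_def)

lemma folding_linv_folding:
  assumes "valid_lifting P Q"
    and "\<And>i. emb_lower P Q i \<le> \<theta> $ i" "\<And>i. \<theta> $ i \<le> emb_upper P Q i"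
  shows "folding_linv P Q (folding Q \<theta>) = \<theta>"
proof -
  have g: "grid Q i 0 = emb_lower P Q i" "grid Q i (pieces Q i) = emb_upper P Q i" for i
    using assms(1) unfolding valid_lifting_def by auto
  have "folding_linv P Q (folding Q \<theta>) $ i = \<theta> $ i" for i
  proof -
    have "(\<Sum>j\<in>{1..pieces Q i}. lcomp Q (folding Q \<theta>) i j)
        = (\<Sum>j\<in>{1..pieces Q i}. folding_comp Q i j (\<theta> $ i))"
      by (intro sum.cong refl lcomp_folding[OF assms(1)])
    then show ?thesis
      using sum_folding_comp[OF assms(1) order_refl, of i "\<theta> $ i"] assms(2,3)[of i] g[of i]
      by (simp add: folding_linv_def)
  qed
  then show ?thesis by (simp add: vec_eq_iff)
qed

text \<open>These bounds define a box, which is convex and contains all folded points,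
  hence also their convex hull.\<close>
lemma convex_hull_folding_bounds:
  assumes "valid_lifting P Q" "\<xi>' \<in> convex hull (folding Q ` S)" "j \<in> {1..pieces Q i}"
  shows "0 \<le> lcomp Q \<xi>' i j" "lcomp Q \<xi>' i j \<le> grid Q i j - grid Q i (j - 1)"
proof -
  let ?w = "\<lambda>p. grid Q (fst p) (snd p) - grid Q (fst p) (snd p - 1)"
  let ?B = "cbox 0 (\<chi> k. ?w (idx Q k))"
  have "folding Q \<theta> \<in> ?B" for \<theta>
  proof -
    have "0 \<le> folding Q \<theta> $ k \<and> folding Q \<theta> $ k \<le> ?w (idx Q k)" for k
    proof -
      obtain i j where k: "idx Q k = (i, j)" by fastforce
      have "grid Q i (j - 1) \<le> grid Q i j"
        by (rule grid_pred_le[OF assms(1) idx_range[OF assms(1) k]])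
      then show ?thesis by (simp add: folding_def k folding_comp_clamp)
    qed
    then show ?thesis by (simp add: mem_box_cart)
  qed
  then have "convex hull (folding Q ` S) \<subseteq> ?B"
    by (intro hull_minimal) (auto intro: convex_box)
  then have "\<xi>' \<in> ?B" using assms(2) by auto
  then have "0 \<le> \<xi>' $ k" "\<xi>' $ k \<le> ?w (idx Q k)" for k
    by (auto simp: mem_box_cart)
  from this[of "inv (idx Q) (i, j)"]
  show "0 \<le> lcomp Q \<xi>' i j" "lcomp Q \<xi>' i j \<le> grid Q i j - grid Q i (j - 1)"
    by (auto simp: lcomp_def idx_inv[OF assms(1,3)])
qed

lemma continuous_on_lift:
  assumes "valid_lifting P Q"
  shows "continuous_on UNIV (lift Q)"
proof -
  have "continuous_on UNIV (\<lambda>\<xi>. lift Q \<xi> $ k)" for k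
  proof -
    obtain i j where k: "idx Q k = (i, j)" by fastforce
    have "lift Q \<xi> $ k = max 0 (min ((emb Q *v \<xi>) $ i - grid Q i (j - 1))
        (grid Q i j - grid Q i (j - 1)))" for \<xi>
      using folding_comp_clamp[OF grid_pred_le[OF assms idx_range[OF assms k]]]
      by (simp add: lift_def folding_def k)
    then show ?thesis by (auto intro!: continuous_intros)
  qed
  then have "continuous_on UNIV (\<lambda>\<xi>. \<chi> k. lift Q \<xi> $ k)"
    by (rule continuous_on_vec_lambda)
  then show ?thesis by simp
qed

section \<open>The embedding and non-anticipativity\<close>

text \<open>The Gram matrix of an injective matrix is nonsingular: \<open>E\<^sup>T E \<xi> = 0\<close> forces \<open>\<parallel>E \<xi>\<parallel>\<^sup>2 = 0\<close>.\<close>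
lemma emb_linv_emb:
  assumes "inj (\<lambda>\<xi>. emb Q *v \<xi>)"
  shows "emb_linv Q *v (emb Q *v \<xi>) = \<xi>"
proof -
  let ?A = "transpose (emb Q) ** emb Q"
  have "\<xi> = 0" if "?A *v \<xi> = 0" for \<xi>
  proof -
    have "(emb Q *v \<xi>) \<bullet> (emb Q *v \<xi>) = \<xi> \<bullet> (?A *v \<xi>)"
      by (metis dot_lmul_matrix inner_commute matrix_vector_mul_assoc transpose_matrix_vector)
    then have "emb Q *v \<xi> = emb Q *v 0" using that by simp
    then show "\<xi> = 0" using assms by (metis injD)
  qed
  then have "\<exists>B. B ** ?A = mat 1" using matrix_left_invertible_ker by blast
  then have "invertible ?A" using invertible_left_inverse by blast
  then have "matrix_inv ?A ** ?A = mat 1"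
    unfolding invertible_def matrix_inv_def by (rule someI2_ex) simp
  then show ?thesis
    by (simp add: emb_linv_def matrix_vector_mul_assoc matrix_mul_assoc[symmetric])
qed

lemma history_eq_iff: "history s t v = history s t w \<longleftrightarrow> (\<forall>k. s k \<le> t \<longrightarrow> v $ k = w $ k)"
  by (auto simp: history_def vec_eq_iff)

lemma history_0: "history s t 0 = 0"
  by (simp add: history_def vec_eq_iff)

text \<open>This is the block-triangular shape of the embedding: row \<open>i\<close> is zero on the parameters that
  are revealed after the stage of \<open>i\<close>.\<close>
lemma history_embedding:
  assumes "valid_lifting P Q" "history (par_stage P) t v = history (par_stage P) t w"
  shows "history (emb_stage Q) t (emb Q *v v) = history (emb_stage Q) t (emb Q *v w)"
proof -
  have "(emb Q *v v) $ i = (emb Q *v w) $ i" if "emb_stage Q i \<le> t" for i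
  proof -
    have "emb Q $ i $ n * v $ n = emb Q $ i $ n * w $ n" for n
    proof (cases "par_stage P n \<le> t")
      case True
      then have "v $ n = w $ n" using assms(2) by (simp add: history_eq_iff)
      then show ?thesis by simp
    next
      case False
      then have "emb Q $ i $ n = 0" using that assms(1) unfolding valid_lifting_def by auto
      then show ?thesis by simp
    qed
    then show ?thesis by (simp only: matrix_vector_mult_def vec_lambda_beta)
  qed
  then show ?thesis by (simp add: history_eq_iff)
qed

text \<open>Composing with the lifting brings a lifted rule back to the original problem, where the
  assumption of a deterministic objective applies to it.\<close>
lemma lift_rule:
  assumes "valid_lifting P Q" "x' \<in> lifted_rules P Q"
  shows "(\<lambda>\<xi>. x' (lift Q \<xi>)) \<in> rules P"
  unfolding rules_def nonanticipative_def
proof (intro CollectI allI impI)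
  fix k v w
  assume "history (par_stage P) (dec_stage P k) v = history (par_stage P) (dec_stage P k) w"
  then have *: "history (emb_stage Q) (dec_stage P k) (emb Q *v v) =
      history (emb_stage Q) (dec_stage P k) (emb Q *v w)"
    by (rule history_embedding[OF assms(1)])
  have eq: "(emb Q *v v) $ i = (emb Q *v w) $ i" if "emb_stage Q i \<le> dec_stage P k" for i
    using * that by (simp add: history_eq_iff)
  have "history (\<lambda>k. emb_stage Q (fst (idx Q k))) (dec_stage P k) (lift Q v) =
      history (\<lambda>k. emb_stage Q (fst (idx Q k))) (dec_stage P k) (lift Q w)"
    by (auto simp: history_eq_iff lift_def folding_def eq split: prod.splits)
  then show "x' (lift Q v) $ k = x' (lift Q w) $ k"
    using assms(2) unfolding lifted_rules_def nonanticipative_def by blast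
qed

lemma affine_map_continuous_on:
  fixes f :: "'a::euclidean_space \<Rightarrow> 'b::real_normed_vector"
  assumes "affine_map f"
  shows "continuous_on S f"
proof -
  obtain h a where h: "linear h" and f: "f = (\<lambda>x. h x + a)"
    using assms unfolding affine_map_def by auto
  show ?thesis unfolding f
    by (intro continuous_intros linear_continuous_on) (use h in \<open>simp add: linear_conv_bounded_linear\<close>)
qed


section \<open>Down-monotone instances\<close>

text \<open>The assumptions that shape the scenarios are collected here; those on the objective and on the right-hand
  sides enter with the lemmas that depend on them.\<close>
locale down_monotone_instance =
  fixes P :: "('n::finite, 'm::finite, 'r::finite, 'g::finite) msp"
    and Q :: "('n, 'i::finite, 'k::finite) lifting"
  assumes msp: "valid_msp P"
    and lifting: "valid_lifting P Q"
    and supp_nonneg: "supp P g \<subseteq> nonneg_orthant"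
    and emb_convex: "convex (emb_supp P Q g)"
    and emb_nonneg: "emb_supp P Q g \<subseteq> nonneg_orthant"
    and axis_mem: "axis i 1 \<in> emb_supp P Q g"
    and emb_down: "down_monotone (emb_supp P Q g)"
begin

lemma par_stage_pos: "par_stage P n \<noteq> 0"
  using msp unfolding valid_msp_def by (metis atLeastAtMost_iff not_one_le_zero)

lemma history_0_eq: "history (par_stage P) 0 v = 0"
  by (simp add: history_def vec_eq_iff par_stage_pos)

text \<open>At the last stage, histories are complete vectors.\<close>
lemma inj_emb: "inj (\<lambda>\<xi>. emb Q *v \<xi>)"
proof -
  let ?T = "horizon P"
  have T: "par_stage P n \<in> {1..?T}" "emb_stage Q i \<in> {1..?T}" for n i
    using msp lifting unfolding valid_msp_def valid_lifting_def by auto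
  then have "?T \<in> {1..?T}" by (metis atLeastAtMost_iff dual_order.trans order_refl)
  then have "inj_on (\<lambda>\<xi>. history (emb_stage Q) ?T (emb Q *v \<xi>)) (range (history (par_stage P) ?T))"
    using lifting unfolding valid_lifting_def by blast
  moreover have "history (par_stage P) ?T = id" "\<And>v. history (emb_stage Q) ?T v = v"
    using T by (auto simp: history_def vec_eq_iff fun_eq_iff)
  ultimately show ?thesis by simp
qed

lemma emb_linv_mem:
  assumes "\<theta> \<in> emb_supp P Q g"
  shows "emb_linv Q *v \<theta> \<in> supp P g" "emb Q *v (emb_linv Q *v \<theta>) = \<theta>"
  using assms emb_linv_emb[OF inj_emb] by (auto simp: emb_supp_def)

lemma zero_mem: "0 \<in> emb_supp P Q g"
proof -
  have "(0::real^'i) \<le> axis undefined 1"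
    by (simp add: less_eq_vec_def axis_def)
  then show ?thesis using emb_down axis_mem unfolding down_monotone_def by blast
qed

text \<open>The columns of \<open>E\<^sup>+\<close> are the points \<open>E\<^sup>+e\<^sub>i\<close>. As \<open>e\<^sub>i\<close> is an embedded scenario, they lie in the
  supports and hence in the non-negative orthant.\<close>
lemma emb_linv_mono:
  assumes "v \<le> w"
  shows "emb_linv Q *v v \<le> emb_linv Q *v w"
proof -
  have "0 \<le> (emb_linv Q *v axis i 1) $ n" for i n
    using emb_linv_mem(1)[OF axis_mem] supp_nonneg
    by (fastforce simp: nonneg_orthant_def less_eq_vec_def)
  then have "0 \<le> emb_linv Q $ n $ i" for n i
    by (simp add: matrix_vector_mult_basis column_def)
  then show ?thesis
    using assms unfolding less_eq_vec_def matrix_vector_mult_def vec_lambda_beta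
    by (intro allI sum_mono mult_left_mono) blast+
qed

text \<open>Up to a stage \<open>t\<close> before that of \<open>i\<close>, the history of \<open>e\<^sub>i = E (E\<^sup>+e\<^sub>i)\<close> is the one of \<open>E 0\<close>,
  so injectivity of the embedding on histories up to \<open>t\<close> applies. This makes the scenario rule
  non-anticipative.\<close>
lemma history_emb_linv_axis:
  assumes "t < emb_stage Q i"
  shows "history (par_stage P) t (emb_linv Q *v axis i 1) = 0"
proof (cases "t = 0")
  case True
  then show ?thesis using history_0_eq by simp
next
  case False
  let ?h = "history (par_stage P) t"
  let ?w = "emb_linv Q *v axis i 1"
  have "emb_stage Q i \<in> {1..horizon P}"
    using lifting unfolding valid_lifting_def by auto
  then have "t \<in> {1..horizon P}" using False assms by auto
  then have inj: "inj_on (\<lambda>\<xi>. history (emb_stage Q) t (emb Q *v \<xi>)) (range ?h)"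
    using lifting unfolding valid_lifting_def by blast
  have "?h (?h ?w) = ?h ?w" by (simp add: history_eq_iff) (simp add: history_def)
  then have "history (emb_stage Q) t (emb Q *v ?h ?w) = history (emb_stage Q) t (emb Q *v ?w)"
    by (rule history_embedding[OF lifting])
  also have "\<dots> = history (emb_stage Q) t (axis i 1)"
    by (simp add: emb_linv_mem(2)[OF axis_mem])
  also have "\<dots> = 0"
    using assms by (auto simp: history_def vec_eq_iff axis_def)
  finally have "history (emb_stage Q) t (emb Q *v ?h ?w) = history (emb_stage Q) t (emb Q *v ?h 0)"
    by (simp add: history_0)
  then have "?h ?w = ?h 0" using inj by (meson inj_onD rangeI)
  then show ?thesis by (simp add: history_0)
qed

lemma compact_emb_supp: "compact (emb_supp P Q g)"
  unfolding emb_supp_def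
  by (intro compact_continuous_image continuous_intros) (use msp in \<open>simp add: valid_msp_def\<close>)

lemma emb_nonneg_component: "\<theta> \<in> emb_supp P Q g \<Longrightarrow> 0 \<le> \<theta> $ i"
  using emb_nonneg by (fastforce simp: nonneg_orthant_def less_eq_vec_def)

lemma emb_lower_eq_0: "emb_lower P Q i = 0"
  unfolding emb_lower_def
proof (rule cInf_eq_minimum)
  show "0 \<in> (\<lambda>\<theta>. \<theta> $ i) ` (\<Union>g. emb_supp P Q g)"
    using zero_mem by (intro image_eqI[of _ _ 0]) auto
qed (auto intro: emb_nonneg_component)

lemma le_emb_upper:
  assumes "\<theta> \<in> emb_supp P Q g"
  shows "\<theta> $ i \<le> emb_upper P Q i"
  unfolding emb_upper_def
proof (rule cSUP_upper)
  have "compact (\<Union>g. emb_supp P Q g)"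
    by (intro compact_UN) (auto intro: compact_emb_supp)
  then have "compact ((\<lambda>\<theta>. \<theta> $ i) ` (\<Union>g. emb_supp P Q g))"
    by (intro compact_continuous_image continuous_intros)
  then show "bdd_above ((\<lambda>\<theta>. \<theta> $ i) ` (\<Union>g. emb_supp P Q g))"
    by (intro bounded_imp_bdd_above compact_imp_bounded)
qed (use assms in auto)

lemma grid_0: "grid Q i 0 = 0"
  using lifting emb_lower_eq_0 unfolding valid_lifting_def by simp

lemma grid_pos: "j \<in> {1..pieces Q i} \<Longrightarrow> 0 < grid Q i j"
  using grid_less[OF lifting, of 0 j i] by (simp add: grid_0)

lemma retract_lift:
  assumes "\<xi> \<in> supp P g"
  shows "retract P Q (lift Q \<xi>) = \<xi>"
proof -
  have mem: "emb Q *v \<xi> \<in> emb_supp P Q g" using assms by (auto simp: emb_supp_def)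
  have "folding_linv P Q (folding Q (emb Q *v \<xi>)) = emb Q *v \<xi>"
    by (rule folding_linv_folding[OF lifting])
      (auto simp: emb_lower_eq_0 intro: emb_nonneg_component[OF mem] le_emb_upper[OF mem])
  then show ?thesis
    by (simp add: retract_def lift_def emb_linv_emb[OF inj_emb])
qed

lemma gridpoint_nonneg:
  assumes "z \<in> gridpoints Q"
  shows "0 \<le> z"
proof -
  have "0 \<le> z $ i" for i
  proof -
    have "z $ i \<in> grid Q i ` {0..pieces Q i}" using assms by (simp add: gridpoints_def)
    then obtain m where m: "m \<le> pieces Q i" "z $ i = grid Q i m" by auto
    then show ?thesis using grid_le_iff[OF lifting, of 0 i m] by (simp add: grid_0)
  qed
  then show ?thesis by (simp add: less_eq_vec_def)
qed

lemma zero_gridpoint: "0 \<in> gridpoints Q"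
proof -
  have "0 \<in> grid Q i ` {0..pieces Q i}" for i
    by (rule image_eqI[of _ _ 0]) (simp_all add: grid_0)
  then show ?thesis by (simp add: gridpoints_def)
qed

lemma finite_gridpoints: "finite (gridpoints Q)"
proof -
  have "gridpoints Q \<subseteq> (\<lambda>f. \<chi> i. f i) ` (PiE UNIV (\<lambda>i. grid Q i ` {0..pieces Q i}))"
  proof
    fix z assume "z \<in> gridpoints Q"
    then have "(\<lambda>i. z $ i) \<in> PiE UNIV (\<lambda>i. grid Q i ` {0..pieces Q i})"
      by (simp add: gridpoints_def PiE_UNIV_domain)
    then show "z \<in> (\<lambda>f. \<chi> i. f i) ` (PiE UNIV (\<lambda>i. grid Q i ` {0..pieces Q i}))"
      by (rule rev_image_eqI) simp
  qed
  then show ?thesis by (rule finite_subset) (intro finite_imageI finite_PiE; simp)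
qed

section \<open>Box distances and the scaling factor\<close>

text \<open>Boundedness of the support makes the supremum in the box distance a true upper bound: the
  distance to a box that contains \<open>0\<close> is at most the norm.\<close>
lemma box_dist_ge:
  assumes "\<theta> \<in> emb_supp P Q g" "0 \<le> z"
    and "\<And>\<theta>'. 0 \<le> \<theta>' \<Longrightarrow> \<theta>' \<le> z \<Longrightarrow> m \<le> l1_norm (\<theta> - \<theta>')"
  shows "m \<le> box_dist P Q g (0, z)"
proof -
  let ?d = "\<lambda>\<theta>. INF \<theta>'\<in>cbox 0 z. l1_norm (\<theta> - \<theta>')"
  have box: "\<theta>' \<in> cbox 0 z \<longleftrightarrow> 0 \<le> \<theta>' \<and> \<theta>' \<le> z" for \<theta>'
    by (auto simp: mem_box_cart less_eq_vec_def)
  have "bdd_above (?d ` emb_supp P Q g)"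
  proof -
    have "compact (l1_norm ` emb_supp P Q g)"
      unfolding l1_norm_def
      by (intro compact_continuous_image continuous_intros compact_emb_supp)
    then obtain M where M: "\<And>\<theta>. \<theta> \<in> emb_supp P Q g \<Longrightarrow> l1_norm \<theta> \<le> M"
      by (meson bdd_above.unfold bounded_imp_bdd_above compact_imp_bounded imageI)
    have "?d \<theta> \<le> M" if "\<theta> \<in> emb_supp P Q g" for \<theta>
    proof -
      have "?d \<theta> \<le> l1_norm (\<theta> - 0)"
        by (rule cINF_lower) (auto simp: box assms(2) l1_norm_def intro!: bdd_belowI[of _ 0] sum_nonneg)
      then show ?thesis using M[OF that] by simp
    qed
    then show ?thesis by (intro bdd_aboveI[of _ M]) auto
  qed
  moreover have "m \<le> ?d \<theta>"
    by (rule cINF_greatest) (use assms(2,3) box in auto)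
  ultimately show ?thesis
    using assms(1) unfolding box_dist_def by (simp add: cSUP_upper2)
qed

lemma component_le_l1_norm: "\<bar>v $ i\<bar> \<le> l1_norm v"
  unfolding l1_norm_def by (rule member_le_sum) auto

text \<open>This is where nonpositive constants in the right-hand sides become usable: a total weight of at
  least 1 only decreases them. Let \<open>\<beta> < 1\<close>. If some \<open>z\<^sub>i \<le> \<beta>\<close>, then \<open>e\<^sub>i\<close> has distance at least
  \<open>1 - \<beta>\<close> from the box. Otherwise \<open>\<beta> < z\<^sub>i \<le> \<beta> \<theta>\<^sub>i\<close> gives \<open>\<theta>\<^sub>i > 1\<close>, and the distance of
  \<open>\<theta>\<close> is at least \<open>\<theta>\<^sub>i - z\<^sub>i \<ge> (1 - \<beta>) \<theta>\<^sub>i\<close>.\<close>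
lemma one_le_scaling_plus_box_dist:
  assumes "\<theta> \<in> emb_supp P Q g" "0 \<le> z" "z \<le> \<beta> *\<^sub>R \<theta>" "0 \<le> \<beta>"
  shows "1 \<le> \<beta> + box_dist P Q g (0, z)"
proof (cases "\<beta> \<ge> 1")
  case True
  have "0 \<le> box_dist P Q g (0, z)"
    by (rule box_dist_ge[OF assms(1,2)]) (simp add: l1_norm_def sum_nonneg)
  then show ?thesis using True by simp
next
  case False
  have "1 - \<beta> \<le> box_dist P Q g (0, z)"
  proof (cases "\<exists>i. z $ i \<le> \<beta>")
    case True
    then obtain i where i: "z $ i \<le> \<beta>" by blast
    show ?thesis
    proof (rule box_dist_ge[OF axis_mem assms(2)])
      fix \<theta>' :: "real^'i" assume "\<theta>' \<le> z"
      then have "1 - \<beta> \<le> \<bar>(axis i 1 - \<theta>') $ i\<bar>"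
        using i by (auto simp: less_eq_vec_def axis_def dest!: spec[of _ i])
      also have "\<dots> \<le> l1_norm (axis i 1 - \<theta>')" by (rule component_le_l1_norm)
      finally show "1 - \<beta> \<le> l1_norm (axis i 1 - \<theta>')" .
    qed
  next
    case no: False
    \<comment> \<open>The index type is nonempty, and any coordinate will do.\<close>
    obtain i :: 'i where True by blast
    have z: "\<beta> < z $ i" "z $ i \<le> \<beta> * \<theta> $ i"
      using no assms(3) by (auto simp: less_eq_vec_def not_le)
    then have "\<beta> * 1 < \<beta> * \<theta> $ i" by linarith
    then have \<theta>: "1 < \<theta> $ i" using assms(4) by (rule mult_left_less_imp_less)
    show ?thesis
    proof (rule box_dist_ge[OF assms(1,2)])
      fix \<theta>' assume "\<theta>' \<le> z"
      then have "\<theta>' $ i \<le> \<beta> * \<theta> $ i" using z(2) by (metis less_eq_vec_def order_trans)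
      moreover have "(1 - \<beta>) * 1 \<le> (1 - \<beta>) * \<theta> $ i"
        using False \<theta> by (intro mult_left_mono) auto
      ultimately have "1 - \<beta> \<le> \<bar>(\<theta> - \<theta>') $ i\<bar>" by (simp add: algebra_simps)
      also have "\<dots> \<le> l1_norm (\<theta> - \<theta>')" by (rule component_le_l1_norm)
      finally show "1 - \<beta> \<le> l1_norm (\<theta> - \<theta>')" .
    qed
  qed
  then show ?thesis by simp
qed

text \<open>The centre \<open>\<theta>0\<close> of the standard simplex lies in every \<open>\<Theta>\<^sub>g\<close> by convexity and dominates \<open>z\<close>
  after scaling by some \<open>\<beta>0\<close>. Factors above \<open>\<beta>0\<close> are irrelevant for the infimum, and the pairs
  of a factor up to \<open>\<beta>0\<close> and a point that it makes dominate \<open>z\<close> form a compact set.\<close>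
lemma scaling_factor_attained:
  obtains \<theta> where "0 \<le> scaling_factor P Q z" "\<And>g. \<theta> \<in> emb_supp P Q g"
    "z \<le> scaling_factor P Q z *\<^sub>R \<theta>"
proof -
  let ?K = "\<Inter>g. emb_supp P Q g"
  let ?n = "real CARD('i)"
  define \<theta>0 :: "real^'i" where "\<theta>0 = (\<Sum>i\<in>UNIV. (1 / ?n) *\<^sub>R axis i 1)"
  define \<beta>0 where "\<beta>0 = ?n * l1_norm z"
  have n: "?n > 0" by simp
  have \<theta>0_nth: "\<theta>0 $ i = 1 / ?n" for i
    by (simp add: \<theta>0_def axis_def if_distrib cong: if_cong)
  have "\<theta>0 \<in> ?K"
    unfolding \<theta>0_def by (intro INT_I convex_sum emb_convex axis_mem) auto
  moreover have "z \<le> \<beta>0 *\<^sub>R \<theta>0"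
    using component_le_l1_norm[of z] by (auto simp: less_eq_vec_def \<beta>0_def \<theta>0_nth intro: abs_le_D1)
  moreover have \<beta>0: "0 \<le> \<beta>0" by (simp add: \<beta>0_def l1_norm_def sum_nonneg)
  ultimately have ne0: "(\<beta>0, \<theta>0) \<in> {0..\<beta>0} \<times> ?K \<inter> {p. z \<le> fst p *\<^sub>R snd p}" by simp
  define C where "C = {0..\<beta>0} \<times> ?K \<inter> {p. z \<le> fst p *\<^sub>R snd p}"
  have ne: "(\<beta>0, \<theta>0) \<in> C" using ne0 by (simp add: C_def)
  have "closed {p. z $ i \<le> fst p * (snd p) $ i}" for i
    by (intro closed_Collect_le continuous_intros)
  then have "closed (\<Inter>i. {p. z $ i \<le> fst p * (snd p) $ i})" by blast
  moreover have "(\<Inter>i. {p. z $ i \<le> fst p * (snd p) $ i}) = {p. z \<le> fst p *\<^sub>R snd p}"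
    by (auto simp: less_eq_vec_def)
  ultimately have cl: "closed {p. z \<le> fst p *\<^sub>R snd p}" by simp
  have "compact ?K"
    by (rule compact_Inter) (auto intro: compact_emb_supp)
  then have "compact C"
    unfolding C_def by (intro compact_Int_closed compact_Times cl) auto
  moreover have "C \<noteq> {}" using ne by blast
  ultimately have "\<exists>p\<in>C. \<forall>q\<in>C. fst p \<le> fst q"
    by (rule continuous_attains_inf) (intro continuous_intros)
  then obtain p where p: "p \<in> C" "\<forall>q\<in>C. fst p \<le> fst q"
    by blast
  have pC: "0 \<le> fst p" "fst p \<le> \<beta>0" "snd p \<in> ?K" "z \<le> fst p *\<^sub>R snd p"
    using p(1) by (auto simp: C_def mem_Times_iff)
  have "scaling_factor P Q z = fst p"
    unfolding scaling_factor_def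
  proof (rule cInf_eq_minimum)
    show "fst p \<in> {\<beta>. 0 \<le> \<beta> \<and> (\<exists>\<theta>'\<in>?K. z \<le> \<beta> *\<^sub>R \<theta>')}" using pC by blast
  next
    fix \<beta> assume "\<beta> \<in> {\<beta>. 0 \<le> \<beta> \<and> (\<exists>\<theta>'\<in>?K. z \<le> \<beta> *\<^sub>R \<theta>')}"
    then obtain \<theta>' where \<theta>': "0 \<le> \<beta>" "\<theta>' \<in> ?K" "z \<le> \<beta> *\<^sub>R \<theta>'" by blast
    show "fst p \<le> \<beta>"
    proof (cases "\<beta> \<le> \<beta>0")
      case True
      then show ?thesis using p(2)[rule_format, of "(\<beta>, \<theta>')"] \<theta>' by (simp add: C_def)
    next
      case False
      then show ?thesis using pC(2) by simp
    qed
  qed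
  then show ?thesis using pC by (intro that[of "snd p"]) auto
qed

end

section \<open>The scenario rule\<close>

text \<open>The part of a lifted vector that belongs to the pieces above \<open>z\<close>, collected per coordinate of
  the embedded space; for a gridpoint \<open>z\<close> and \<open>\<xi>' = F(\<theta>)\<close> with \<open>\<theta>\<close> in the range of the grid
  it is the positive part of \<open>\<theta> - z\<close>.\<close>
definition excess :: "('n::finite, 'i::finite, 'k::finite) lifting \<Rightarrow> real^'i \<Rightarrow> real^'k \<Rightarrow> real^'i" where
  "excess Q z \<xi>' = (\<chi> i. \<Sum>j\<in>{j\<in>{1..pieces Q i}. z $ i < grid Q i j}. lcomp Q \<xi>' i j)"

lemma linear_excess: "linear (excess Q z)"
  by (rule linearI)
    (simp_all add: excess_def lcomp_def vec_eq_iff sum.distrib sum_distrib_left)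

text \<open>The terms in \<open>x(0)\<close> are grouped with the excess, so that the excess in \<open>i\<close> is multiplied by the
  difference \<open>x(E\<^sup>+e\<^sub>i) - x(0)\<close>.\<close>
definition scenario_rule ::
  "('n::finite, 'i::finite, 'k::finite) lifting \<Rightarrow> (real^'n \<Rightarrow> real^'m::finite) \<Rightarrow> real^'i \<Rightarrow>
   real \<Rightarrow> real^'i \<Rightarrow> real \<Rightarrow> real^'k \<Rightarrow> real^'m" where
  "scenario_rule Q x z \<beta> \<theta> d \<xi>' =
     \<beta> *\<^sub>R x (emb_linv Q *v \<theta>) + d *\<^sub>R x 0
     + (\<Sum>i\<in>UNIV. excess Q z \<xi>' $ i *\<^sub>R (x (emb_linv Q *v axis i 1) - x 0))"

lemma affine_map_scenario_rule: "affine_map (scenario_rule Q x z \<beta> \<theta> d)"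
proof -
  have "linear (\<lambda>\<xi>'. \<Sum>i\<in>UNIV. excess Q z \<xi>' $ i *\<^sub>R (x (emb_linv Q *v axis i 1) - x 0))"
    by (rule linearI)
      (simp_all add: linear_add[OF linear_excess] linear_scale[OF linear_excess]
        scaleR_left_distrib sum.distrib scaleR_sum_right)
  then show ?thesis
    unfolding affine_map_def scenario_rule_def by (auto simp: add.commute)
qed

context down_monotone_instance
begin

text \<open>For a decision of stage \<open>t\<close>, the excess in a coordinate of stage up to \<open>t\<close> is observable, and for
  a later coordinate its coefficient vanishes.\<close>
lemma scenario_rule_mem_lifted_rules:
  assumes x: "x \<in> rules P"
  shows "scenario_rule Q x z \<beta> \<theta> d \<in> lifted_rules P Q"
  unfolding lifted_rules_def nonanticipative_def
proof (intro CollectI allI impI)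
  fix k v w
  let ?t = "dec_stage P k"
  let ?s = "\<lambda>l. emb_stage Q (fst (idx Q l))"
  assume "history ?s ?t v = history ?s ?t w"
  then have vw: "v $ l = w $ l" if "?s l \<le> ?t" for l
    using that by (simp add: history_eq_iff)
  have "excess Q z v $ i * (x (emb_linv Q *v axis i 1) $ k - x 0 $ k)
      = excess Q z w $ i * (x (emb_linv Q *v axis i 1) $ k - x 0 $ k)" for i
  proof (cases "emb_stage Q i \<le> ?t")
    case True
    have "lcomp Q v i j = lcomp Q w i j" if "j \<in> {1..pieces Q i}" for j
      unfolding lcomp_def by (rule vw) (simp add: idx_inv[OF lifting that] True)
    then have "excess Q z v $ i = excess Q z w $ i"
      by (simp add: excess_def)
    then show ?thesis by simp
  next
    case False
    then have "history (par_stage P) ?t (emb_linv Q *v axis i 1) = history (par_stage P) ?t 0"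
      using history_emb_linv_axis by (simp add: history_0)
    then have "x (emb_linv Q *v axis i 1) $ k = x 0 $ k"
      using x unfolding rules_def nonanticipative_def by blast
    then show ?thesis by simp
  qed
  then have "(\<Sum>i\<in>UNIV. excess Q z v $ i * (x (emb_linv Q *v axis i 1) $ k - x 0 $ k))
      = (\<Sum>i\<in>UNIV. excess Q z w $ i * (x (emb_linv Q *v axis i 1) $ k - x 0 $ k))"
    by (intro sum.cong refl)
  then show "scenario_rule Q x z \<beta> \<theta> d v $ k = scenario_rule Q x z \<beta> \<theta> d w $ k"
    by (simp add: scenario_rule_def)
qed

lemma static_component:
  assumes "x \<in> rules P" "dec_stage P k = 0"
  shows "x v $ k = x w $ k"
proof -
  have "history (par_stage P) (dec_stage P k) v = history (par_stage P) (dec_stage P k) w"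
    by (simp add: assms(2) history_0_eq)
  then show ?thesis using assms(1) unfolding rules_def nonanticipative_def by blast
qed

lemma static_component_scenario_rule:
  assumes "x \<in> rules P" "dec_stage P k = 0"
  shows "scenario_rule Q x z \<beta> \<theta> d \<xi>' $ k = (\<beta> + d) * x 0 $ k"
proof -
  have eq: "x v $ k = x 0 $ k" for v by (rule static_component[OF assms])
  show ?thesis
    by (simp add: scenario_rule_def distrib_right eq[of "emb_linv Q *v \<theta>"]
        eq[of "emb_linv Q *v axis i 1" for i])
qed

lemma excess_nonneg:
  assumes "\<xi>' \<in> outer_approx P Q g"
  shows "0 \<le> excess Q z \<xi>' $ i"
proof -
  have hull: "\<xi>' \<in> convex hull (folding Q ` bounding_box (emb_supp P Q g))"
    using assms by (simp add: outer_approx_def)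
  show ?thesis
    unfolding excess_def vec_lambda_beta
    by (intro sum_nonneg convex_hull_folding_bounds(1)[OF lifting hull]) blast
qed

text \<open>The pieces up to a breakpoint \<open>z\<^sub>i\<close> have total length \<open>z\<^sub>i\<close>, as the grid starts at \<open>0\<close>.\<close>
lemma folding_linv_le:
  assumes \<xi>': "\<xi>' \<in> outer_approx P Q g" and z: "z \<in> gridpoints Q"
  shows "folding_linv P Q \<xi>' \<le> z + excess Q z \<xi>'"
proof -
  have "folding_linv P Q \<xi>' $ i \<le> z $ i + excess Q z \<xi>' $ i" for i
  proof -
    have "z $ i \<in> grid Q i ` {0..pieces Q i}" using z by (simp add: gridpoints_def)
    then obtain m where m: "m \<le> pieces Q i" "z $ i = grid Q i m" by auto
    have le: "lcomp Q \<xi>' i j \<le> grid Q i j - grid Q i (j - 1)" if "j \<in> {1..pieces Q i}" for j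
      using \<xi>' convex_hull_folding_bounds(2)[OF lifting _ that] unfolding outer_approx_def by blast
    have lower: "{j\<in>{1..pieces Q i}. \<not> z $ i < grid Q i j} = {1..m}"
      using m grid_le_iff[OF lifting, of _ i m] by (auto simp: not_less)
    have "folding_linv P Q \<xi>' $ i = (\<Sum>j\<in>{1..pieces Q i}. lcomp Q \<xi>' i j)"
      by (simp add: folding_linv_def emb_lower_eq_0)
    also have "\<dots> = (\<Sum>j\<in>{1..m}. lcomp Q \<xi>' i j) + excess Q z \<xi>' $ i"
      unfolding lower[symmetric] excess_def vec_lambda_beta
      by (subst sum.union_disjoint[symmetric]) (auto intro!: sum.cong)
    also have "(\<Sum>j\<in>{1..m}. lcomp Q \<xi>' i j) \<le> (\<Sum>j\<in>{1..m}. grid Q i j - grid Q i (j - 1))"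
      using m by (intro sum_mono le) auto
    also have "\<dots> = z $ i" by (simp only: sum_grid_increments grid_0 m)
    finally show ?thesis by simp
  qed
  then show ?thesis by (simp add: less_eq_vec_def)
qed

text \<open>For boxes with lower corner \<open>0\<close>, the cuts bound the total excess.\<close>
lemma lifted_box_dist_from_0: "lifted_box_dist P Q \<xi>' (0, z) = (\<Sum>i\<in>UNIV. excess Q z \<xi>' $ i)"
proof -
  have empty: "{j\<in>{1..pieces Q i}. grid Q i j \<le> 0} = {}" for i
    using grid_pos by fastforce
  show ?thesis
    unfolding lifted_box_dist_def excess_def fst_conv snd_conv zero_index empty by (simp add: emb_lower_eq_0)
qed

text \<open>Admissibility of \<open>0\<close> makes the minimum over admissible gridpoints meaningful. The cut for
  \<open>[0, 0]\<close> only compares the \<open>1\<close>-norm of \<open>F\<^sup>+(\<xi>') \<in> \<Theta>\<^sub>g\<close> with the largest \<open>1\<close>-norm on \<open>\<Theta>\<^sub>g\<close>.\<close>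
lemma zero_mem_cut_gridpoints: "0 \<in> cut_gridpoints P Q ZA"
  unfolding cut_gridpoints_def
proof (intro CollectI conjI zero_gridpoint allI ballI)
  fix g \<xi>' assume "\<xi>' \<in> cut_outer_approx P Q ZA g"
  then have mem: "folding_linv P Q \<xi>' \<in> emb_supp P Q g"
    unfolding cut_outer_approx_def outer_approx_def by blast
  have "{j\<in>{1..pieces Q i}. 0 < grid Q i j} = {1..pieces Q i}" for i
    using grid_pos by blast
  then have "excess Q 0 \<xi>' = folding_linv P Q \<xi>'"
    by (simp add: excess_def folding_linv_def emb_lower_eq_0)
  moreover have "(\<Sum>i\<in>UNIV. folding_linv P Q \<xi>' $ i) \<le> box_dist P Q g (0, 0)"
  proof (rule box_dist_ge[OF mem])
    fix \<theta>' :: "real^'i" assume "0 \<le> \<theta>'" "\<theta>' \<le> 0"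
    then have "\<theta>' = 0" by (rule order_antisym[rotated])
    then show "(\<Sum>i\<in>UNIV. folding_linv P Q \<xi>' $ i) \<le> l1_norm (folding_linv P Q \<xi>' - \<theta>')"
      by (simp add: l1_norm_def sum_mono)
  qed simp
  ultimately show "cut P Q g (0, 0) \<xi>'"
    by (simp add: cut_def lifted_box_dist_from_0)
qed

text \<open>The constraint at \<open>\<xi>'\<close> is dominated by the combination of the constraints at \<open>E\<^sup>+\<theta>\<close>, \<open>E\<^sup>+e\<^sub>i\<close>
  and \<open>0\<close> with weights \<open>\<beta>\<close>, the excess in \<open>i\<close>, and \<open>d\<close> minus the total excess.\<close>
lemma scenario_rule_feasible:
  assumes x: "x \<in> feasible_rules P"
    and rhs: "nonpositive_rhs P"
    and z: "z \<in> gridpoints Q" "z \<le> \<beta> *\<^sub>R \<theta>"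
    and \<beta>: "0 \<le> \<beta>" and \<theta>: "\<theta> \<in> emb_supp P Q g"
    and \<xi>': "\<xi>' \<in> outer_approx P Q g"
    and d: "(\<Sum>i\<in>UNIV. excess Q z \<xi>' $ i) \<le> d" "1 \<le> \<beta> + d"
    and r: "r \<in> rows P g"
  shows "(lhs P g *v scenario_rule Q x z \<beta> \<theta> d \<xi>') $ r \<le> rhs P g (retract P Q \<xi>') $ r"
proof -
  let ?u = "\<lambda>i. excess Q z \<xi>' $ i"
  let ?s = "\<lambda>i. emb_linv Q *v axis i 1"
  let ?v = "emb_linv Q *v \<theta>"
  define a where "a = (\<lambda>y. (lhs P g *v x y) $ r)"
  obtain B :: "real^'n^'r" and b where Bb: "\<And>\<xi>. rhs P g \<xi> = B *v \<xi> + b"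
    "\<And>n. B $ r $ n \<le> 0" "b $ r \<le> 0"
    using rhs r unfolding nonpositive_rhs_def by metis
  define h where "h = (\<lambda>y. (B *v y) $ r)"
  have lin_h: "linear h"
    unfolding h_def by (rule linearI) (simp_all add: matrix_vector_right_distrib matrix_vector_mult_scaleR)
  have lin_a: "linear (\<lambda>y. (lhs P g *v y) $ r)"
    by (rule linearI) (simp_all add: matrix_vector_right_distrib matrix_vector_mult_scaleR)
  have a_le: "a y \<le> h y + b $ r" if "y \<in> supp P g" for y
  proof -
    have "a y \<le> rhs P g y $ r"
      using x that r unfolding feasible_rules_def a_def by blast
    then show ?thesis by (simp add: Bb(1) h_def)
  qed
  have a_v: "a ?v \<le> h ?v + b $ r" by (rule a_le[OF emb_linv_mem(1)[OF \<theta>]])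
  have a_s: "a (?s i) \<le> h (?s i) + b $ r" for i by (rule a_le[OF emb_linv_mem(1)[OF axis_mem]])
  have a_0: "a 0 \<le> b $ r"
    using a_le[OF emb_linv_mem(1)[OF zero_mem]] by (simp add: linear_0[OF lin_h])
  have "(lhs P g *v scenario_rule Q x z \<beta> \<theta> d \<xi>') $ r
      = \<beta> * a ?v + d * a 0 + (\<Sum>i\<in>UNIV. ?u i * (a (?s i) - a 0))"
    unfolding scenario_rule_def a_def
    by (simp add: linear_add[OF lin_a] linear_scale[OF lin_a] linear_sum[OF lin_a] linear_diff[OF lin_a])
  also have "\<dots> = \<beta> * a ?v + (d - (\<Sum>i\<in>UNIV. ?u i)) * a 0 + (\<Sum>i\<in>UNIV. ?u i * a (?s i))"
    by (simp add: algebra_simps sum_subtractf sum_distrib_left)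
  also have "\<dots> \<le> \<beta> * (h ?v + b $ r) + (d - (\<Sum>i\<in>UNIV. ?u i)) * b $ r
      + (\<Sum>i\<in>UNIV. ?u i * (h (?s i) + b $ r))"
    using d(1) \<beta> excess_nonneg[OF \<xi>']
    by (intro add_mono mult_left_mono sum_mono a_v a_s a_0) auto
  also have "\<dots> = h (\<beta> *\<^sub>R ?v + (\<Sum>i\<in>UNIV. ?u i *\<^sub>R ?s i)) + (\<beta> + d) * b $ r"
    by (simp add: linear_add[OF lin_h] linear_scale[OF lin_h] linear_sum[OF lin_h]
        algebra_simps sum.distrib sum_distrib_left)
  also have "\<beta> *\<^sub>R ?v + (\<Sum>i\<in>UNIV. ?u i *\<^sub>R ?s i) = emb_linv Q *v (\<beta> *\<^sub>R \<theta> + excess Q z \<xi>')"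
  proof -
    have "emb_linv Q *v excess Q z \<xi>' = emb_linv Q *v (\<Sum>i\<in>UNIV. ?u i *\<^sub>R axis i 1)"
      using basis_expansion[of "excess Q z \<xi>'"] by (simp add: scalar_mult_eq_scaleR)
    also have "\<dots> = (\<Sum>i\<in>UNIV. ?u i *\<^sub>R ?s i)"
      by (simp add: linear_sum[OF matrix_vector_mul_linear] matrix_vector_mult_scaleR)
    finally show ?thesis
      by (simp add: matrix_vector_right_distrib matrix_vector_mult_scaleR)
  qed
  also have "h (emb_linv Q *v (\<beta> *\<^sub>R \<theta> + excess Q z \<xi>')) \<le> h (retract P Q \<xi>')"
  proof -
    have "folding_linv P Q \<xi>' \<le> \<beta> *\<^sub>R \<theta> + excess Q z \<xi>'"
      using folding_linv_le[OF \<xi>' z(1)] z(2) by (meson add_right_mono order_trans)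
    then have "retract P Q \<xi>' \<le> emb_linv Q *v (\<beta> *\<^sub>R \<theta> + excess Q z \<xi>')"
      unfolding retract_def by (rule emb_linv_mono)
    then show ?thesis
      unfolding h_def matrix_vector_mult_def vec_lambda_beta
      by (intro sum_mono mult_left_mono_neg Bb(2)) (simp add: less_eq_vec_def)
  qed
  also have "(\<beta> + d) * b $ r \<le> 1 * b $ r"
    using d(2) Bb(3) by (rule mult_right_mono_neg)
  finally show ?thesis by (simp add: Bb(1) h_def)
qed

section \<open>Objective values and the bound\<close>

text \<open>Almost surely the integrand is a function of the here-and-now decision alone, hence constant.
  The function \<open>f\<close> has to agree with the objective only on the supports: the lifted
  problem evaluates the cost at \<open>R(L(\<xi>))\<close>, which is sure to equal \<open>\<xi>\<close> only there.\<close>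
lemma integral_deterministic_objective:
  assumes det: "\<forall>x\<in>rules P. \<forall>\<xi>\<in>(\<Union>g. supp P g).
        cost P \<xi> \<bullet> x \<xi> = (\<Sum>k\<in>{k. dec_stage P k = 0}. c $ k * x \<xi> $ k)"
    and x: "x \<in> rules P"
    and f: "f \<in> borel_measurable (distrib P)" "\<And>g \<xi>. \<xi> \<in> supp P g \<Longrightarrow> f \<xi> = cost P \<xi> \<bullet> x \<xi>"
  shows "integrable (distrib P) f"
    and "(LINT \<xi>|distrib P. f \<xi>) = (\<Sum>k\<in>{k. dec_stage P k = 0}. c $ k * x 0 $ k)"
proof -
  let ?v = "\<Sum>k\<in>{k. dec_stage P k = 0}. c $ k * x 0 $ k"
  have prob: "prob_space (distrib P)" and ae: "AE \<xi> in distrib P. \<xi> \<in> (\<Union>g. supp P g)"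
    using msp unfolding valid_msp_def by auto
  interpret prob_space "distrib P" by (rule prob)
  have "f \<xi> = ?v" if "\<xi> \<in> (\<Union>g. supp P g)" for \<xi>
  proof -
    have "f \<xi> = (\<Sum>k\<in>{k. dec_stage P k = 0}. c $ k * x \<xi> $ k)"
      using f(2) that det x by auto
    also have "\<dots> = ?v" using static_component[OF x, of _ \<xi> 0] by (intro sum.cong) auto
    finally show ?thesis .
  qed
  then have ae': "AE \<xi> in distrib P. f \<xi> = ?v"
    using ae by (auto elim: eventually_mono)
  then have "integrable (distrib P) f \<longleftrightarrow> integrable (distrib P) (\<lambda>_. ?v)"
    by (intro integrable_cong_AE f(1)) auto
  then show "integrable (distrib P) f" by simp
  have "(LINT \<xi>|distrib P. f \<xi>) = (LINT \<xi>|distrib P. ?v)"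
    by (intro integral_cong_AE f(1) ae') auto
  then show "(LINT \<xi>|distrib P. f \<xi>) = ?v" by (simp add: prob_space)
qed

lemma lift_measurable: "lift Q \<in> borel_measurable (distrib P)"
proof -
  have "sets (distrib P) = sets borel" using msp unfolding valid_msp_def by simp
  then show ?thesis
    using borel_measurable_continuous_onI[OF continuous_on_lift[OF lifting]]
    by (simp cong: measurable_cong_sets)
qed

lemma aff_lifted_opt_value_le:
  assumes "deterministic_objective P" and rhs: "nonpositive_rhs P"
    and z: "z \<in> cut_gridpoints P Q ZA"
  shows "aff_lifted_opt_value P Q (cut_outer_approx P Q ZA)
    \<le> ereal (scaling_factor P Q z + (MAX g\<in>UNIV. box_dist P Q g (0, z))) * opt_value P"
proof -
  define d where "d = (MAX g\<in>UNIV. box_dist P Q g (0, z))"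
  define \<beta> where "\<beta> = scaling_factor P Q z"
  obtain c :: "real^'m" where c: "\<forall>x\<in>rules P. \<forall>\<xi>\<in>(\<Union>g. supp P g).
        cost P \<xi> \<bullet> x \<xi> = (\<Sum>k\<in>{k. dec_stage P k = 0}. c $ k * x \<xi> $ k)"
    using assms(1) unfolding deterministic_objective_def by blast
  obtain \<theta> where \<theta>: "0 \<le> \<beta>" "\<And>g. \<theta> \<in> emb_supp P Q g" "z \<le> \<beta> *\<^sub>R \<theta>"
    unfolding \<beta>_def using scaling_factor_attained[of z] by blast
  have zg: "z \<in> gridpoints Q" using z by (simp add: cut_gridpoints_def)
  have d: "box_dist P Q g (0, z) \<le> d" for g unfolding d_def by (intro Max_ge) auto
  have one: "1 \<le> \<beta> + d"
    using one_le_scaling_plus_box_dist[OF \<theta>(2) gridpoint_nonneg[OF zg] \<theta>(3,1)] d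
    by (meson add_left_mono order_trans)
  let ?obj = "\<lambda>x. LINT \<xi>|distrib P. cost P \<xi> \<bullet> x \<xi>"
  let ?L = "aff_lifted_opt_value P Q (cut_outer_approx P Q ZA)"
  have le: "?L \<le> ereal (\<beta> + d) * ereal (?obj x)" if x: "x \<in> feasible_rules P" for x
  proof -
    let ?x' = "scenario_rule Q x z \<beta> \<theta> d"
    let ?f = "\<lambda>\<xi>'. cost P (retract P Q \<xi>') \<bullet> ?x' \<xi>'"
    have xr: "x \<in> rules P" and xi: "integrable (distrib P) (\<lambda>\<xi>. cost P \<xi> \<bullet> x \<xi>)"
      using x by (auto simp: feasible_rules_def)
    have x'r: "?x' \<in> lifted_rules P Q" by (rule scenario_rule_mem_lifted_rules[OF xr])
    have "continuous_on UNIV (retract P Q)"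
      unfolding retract_def folding_linv_def lcomp_def
      by (intro continuous_intros continuous_on_compose2[OF matrix_vector_mult_linear_continuous_on[of UNIV]]) auto
    moreover have "continuous_on UNIV (cost P)"
      using msp by (intro affine_map_continuous_on) (simp add: valid_msp_def)
    ultimately have "continuous_on UNIV (\<lambda>\<xi>'. cost P (retract P Q \<xi>'))"
      using continuous_on_compose2[of UNIV "cost P" UNIV "retract P Q"] by simp
    moreover have "continuous_on UNIV ?x'"
      by (rule affine_map_continuous_on[OF affine_map_scenario_rule])
    ultimately have "continuous_on UNIV ?f" by (rule continuous_on_inner)
    then have f: "?f \<in> borel_measurable borel" by (rule borel_measurable_continuous_onI)
    have fl: "(\<lambda>\<xi>. ?f (lift Q \<xi>)) \<in> borel_measurable (distrib P)"
      by (rule measurable_compose[OF lift_measurable f])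
    note obj' = integral_deterministic_objective[OF c lift_rule[OF lifting x'r] fl]
    have "integrable (distrib P) (\<lambda>\<xi>. ?f (lift Q \<xi>))"
      by (rule obj'(1)) (simp add: retract_lift)
    then have int: "integrable (lifted_distrib P Q) ?f"
      unfolding lifted_distrib_def by (simp add: integrable_distr_eq[OF lift_measurable f])
    have "(LINT \<xi>'|lifted_distrib P Q. ?f \<xi>') = (LINT \<xi>|distrib P. ?f (lift Q \<xi>))"
      unfolding lifted_distrib_def by (rule integral_distr[OF lift_measurable f])
    also have "\<dots> = (\<Sum>k\<in>{k. dec_stage P k = 0}. c $ k * ?x' (lift Q 0) $ k)"
      by (rule obj'(2)) (simp add: retract_lift)
    also have "\<dots> = (\<beta> + d) * (\<Sum>k\<in>{k. dec_stage P k = 0}. c $ k * x 0 $ k)"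
      by (simp add: static_component_scenario_rule[OF xr] sum_distrib_left mult.left_commute)
    also have "(\<Sum>k\<in>{k. dec_stage P k = 0}. c $ k * x 0 $ k) = ?obj x"
      by (rule integral_deterministic_objective(2)[OF c xr, symmetric]) (use xi in auto)
    finally have obj: "(LINT \<xi>'|lifted_distrib P Q. ?f \<xi>') = (\<beta> + d) * ?obj x" .
    have "(lhs P g *v ?x' \<xi>') $ r \<le> rhs P g (retract P Q \<xi>') $ r"
      if \<xi>': "\<xi>' \<in> cut_outer_approx P Q ZA g" and r: "r \<in> rows P g" for g \<xi>' r
    proof (rule scenario_rule_feasible[OF x rhs zg \<theta>(3,1,2) _ _ one r])
      show "\<xi>' \<in> outer_approx P Q g" using \<xi>' by (simp add: cut_outer_approx_def)
      have "cut P Q g (0, z) \<xi>'" using z \<xi>' unfolding cut_gridpoints_def by blast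
      then show "(\<Sum>i\<in>UNIV. excess Q z \<xi>' $ i) \<le> d"
        using d[of g] by (simp add: cut_def lifted_box_dist_from_0)
    qed
    then have "?x' \<in> {x' \<in> lifted_feasible_rules P Q (cut_outer_approx P Q ZA). affine_map x'}"
      using x'r int affine_map_scenario_rule by (auto simp: lifted_feasible_rules_def)
    then have "?L \<le> ereal (LINT \<xi>'|lifted_distrib P Q. ?f \<xi>')"
      unfolding aff_lifted_opt_value_def by (rule INF_lower)
    then show ?thesis by (simp add: obj)
  qed
  have "ereal (\<beta> + d) * opt_value P
      = Inf {ereal (\<beta> + d) * y |y. y \<in> (\<lambda>x. ereal (?obj x)) ` feasible_rules P}"
    using one unfolding opt_value_def by (subst ereal_Inf_cmult) auto
  moreover have "?L \<le> \<dots>"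
    by (rule Inf_greatest) (use le in blast)
  ultimately show ?thesis by (simp add: \<beta>_def d_def)
qed

lemma aff_lifted_opt_value_le_Min:
  assumes "deterministic_objective P" "nonpositive_rhs P"
  shows "aff_lifted_opt_value P Q (cut_outer_approx P Q ZA)
    \<le> ereal (MIN z\<in>cut_gridpoints P Q ZA.
        scaling_factor P Q z + (MAX g\<in>UNIV. box_dist P Q g (0, z))) * opt_value P"
proof -
  let ?f = "\<lambda>z. scaling_factor P Q z + (MAX g\<in>UNIV. box_dist P Q g (0, z))"
  let ?Z = "cut_gridpoints P Q ZA"
  have "finite ?Z"
    by (rule finite_subset[OF _ finite_gridpoints]) (auto simp: cut_gridpoints_def)
  then have "Min (?f ` ?Z) \<in> ?f ` ?Z"
    using zero_mem_cut_gridpoints by (intro Min_in) auto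
  then obtain z where "z \<in> ?Z" "Min (?f ` ?Z) = ?f z" by blast
  then show ?thesis using aff_lifted_opt_value_le[OF assms] by simp
qed

text \<open>The cut for \<open>[0, z]\<close> is among those imposed.\<close>
lemma cut_gridpoints_gridboxes: "cut_gridpoints P Q (\<lambda>g. gridboxes Q) = gridpoints Q"
  using zero_gridpoint gridpoint_nonneg
  by (fastforce simp: cut_gridpoints_def cut_outer_approx_def gridboxes_def)

end

theorem proposition5:
  fixes P :: "('n::finite, 'm::finite, 'r::finite, 'g::finite) msp"
    and Q :: "('n, 'i::finite, 'k::finite) lifting"
    and ZA :: "'g \<Rightarrow> ((real^'i) \<times> (real^'i)) set"
  assumes "valid_msp P" and "valid_lifting P Q"
    and "deterministic_objective P"
    and "nonpositive_rhs P"
    and "\<And>g. supp P g \<subseteq> nonneg_orthant \<and> full_dimensional (supp P g) \<and> down_monotone (supp P g)"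
    and "\<And>g. convex (emb_supp P Q g) \<and> emb_supp P Q g \<subseteq> nonneg_orthant \<and>
             full_dimensional (emb_supp P Q g) \<and> (\<forall>i. axis i 1 \<in> emb_supp P Q g) \<and>
             down_monotone (emb_supp P Q g)"
    and "\<And>g. ZA g \<subseteq> gridboxes Q"
  shows "aff_lifted_opt_value P Q (refined_outer_approx P Q)
           \<le> ereal (MIN z\<in>gridpoints Q.
                scaling_factor P Q z + (MAX g\<in>UNIV. box_dist P Q g (0, z))) * opt_value P \<and>
         aff_lifted_opt_value P Q (cut_outer_approx P Q ZA)
           \<le> ereal (MIN z\<in>cut_gridpoints P Q ZA.
                scaling_factor P Q z + (MAX g\<in>UNIV. box_dist P Q g (0, z))) * opt_value P"
proof -
  interpret down_monotone_instance P Q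
    by unfold_locales (use assms(1,2,5,6) in blast)+
  show ?thesis
    using aff_lifted_opt_value_le_Min[OF assms(3,4), of "\<lambda>g. gridboxes Q"]
      aff_lifted_opt_value_le_Min[OF assms(3,4), of ZA]
    by (simp add: refined_outer_approx_def cut_gridpoints_gridboxes)
qed

end
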